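(* Let $A$, $B$, $\mathbb{Y}$, $B_1$, $C_1$ and $C_1-B_1$ be positive stable matrices in $\mathbb{C}^{r\times r}$ such that $B_1C_1=C_1B_1$. Then for every integer $n\ge0$ and every $z\in\mathbb{C}$, $$\frac{d^n}{dz^n}\,{}_1F_1^{(A,B;\mathbb{Y})}(B_1;C_1;z)={}_1F_1^{(A,B;\mathbb{Y})}(B_1+nI;C_1+nI;z)\;(B_1)_n\,(C_1)_n^{-1}.$$
   Context: A matrix in $\mathbb{C}^{r\times r}$ is positive stable if all its eigenvalues have positive real part; $I$ is the identity matrix. For $t>0$ and a square matrix $M$, $t^M=\exp(M\ln t)$. The Pochhammer symbol is $(M)_0=I$, $(M)_n=M(M+I)\cdots(M+(n-1)I)$ for $n\ge1$, and $(M)_n^{-1}$ is the inverse of $(M)_n$. For positive stable $B$ and a square matrix $W$, ${}_1F_1(A;B;W)=\sum_{n\ge0}(A)_n\,(B)_n^{-1}\,\frac{W^n}{n!}$. For commuting positive stable $P,Q$, the beta matrix function is $\mathfrak{B}(P,Q)=\Gamma(P)\Gamma(Q)\Gamma^{-1}(P+Q)=\int_0^1t^{P-I}(1-t)^{Q-I}dt$, where $\Gamma(P)=\int_0^\infty e^{-t}t^{P-I}dt$. For positive stable $A,B,P,Q,\mathbb{Y}$, $$\mathfrak{B}_{\mathbb{Y}}^{(A,B)}(P,Q)=\int_0^1 {}_1F_1\!\left(A;B;-\frac{\mathbb{Y}}{t(1-t)}\right)t^{P-I}(1-t)^{Q-I}\,dt .$$ The new extended confluent hypergeometric matrix function is $${}_1F_1^{(A,B;\mathbb{Y})}(B_1;C_1;z)=\sum_{n=0}^\infty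 \mathfrak{B}_{\mathbb{Y}}^{(A,B)}(B_1+nI,C_1-B_1)\,[\mathfrak{B}(B_1,C_1-B_1)]^{-1}\,\frac{z^n}{n!}.$$ *)

theory Defs
  imports "HOL-Analysis.Analysis"
begin

text \<open>
  Pitfall: on \<open>complex^'n^'n\<close> the class operations \<open>*\<close>, \<open>^\<close> and \<open>1\<close> are entrywise, so matrix products
  are written with \<open>**\<close>, the identity matrix is \<open>mat 1\<close>, and powers, the exponential and Pochhammer
  symbols are defined here. The scalar matrix \<open>cI\<close> is \<open>mat c\<close>.
\<close>

definition positive_stable :: "complex^'n^'n \<Rightarrow> bool" where
  "positive_stable M \<longleftrightarrow> (\<forall>c v. v \<noteq> 0 \<and> M *v v = c *s v \<longrightarrow> Re c > 0)"

primrec mpow :: "complex^'n^'n \<Rightarrow> nat \<Rightarrow> complex^'n^'n" where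
  "mpow M 0 = mat 1"
| "mpow M (Suc n) = mpow M n ** M"

definition mexp :: "complex^'n^'n \<Rightarrow> complex^'n^'n" where
  "mexp M = (\<Sum>n. (1 / fact n) *\<^sub>R mpow M n)"

text \<open>\<open>rpow t M\<close> is $t^M$; it is only meant for \<open>t > 0\<close>.\<close>

definition rpow :: "real \<Rightarrow> complex^'n^'n \<Rightarrow> complex^'n^'n" where
  "rpow t M = mexp (ln t *\<^sub>R M)"

primrec mpoch :: "complex^'n^'n \<Rightarrow> nat \<Rightarrow> complex^'n^'n" where
  "mpoch M 0 = mat 1"
| "mpoch M (Suc n) = mpoch M n ** (M + mat (of_nat n))"

text \<open>The order of the factors matters, since no commutation of \<open>A\<close>, \<open>B\<close>, \<open>W\<close> is assumed.\<close>

definition mhyp1F1 :: "complex^'n^'n \<Rightarrow> complex^'n^'n \<Rightarrow> complex^'n^'n \<Rightarrow> complex^'n^'n" where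
  "mhyp1F1 A B W =
     (\<Sum>n. mpoch A n ** matrix_inv (mpoch B n) ** ((1 / fact n) *\<^sub>R mpow W n))"

definition mGamma :: "complex^'n^'n \<Rightarrow> complex^'n^'n" where
  "mGamma P = (LINT t:{0<..}|lborel. exp (- t) *\<^sub>R rpow t (P - mat 1))"

definition mBeta :: "complex^'n^'n \<Rightarrow> complex^'n^'n \<Rightarrow> complex^'n^'n" where
  "mBeta P Q = mGamma P ** mGamma Q ** matrix_inv (mGamma (P + Q))"

definition ext_mBeta ::
  "complex^'n^'n \<Rightarrow> complex^'n^'n \<Rightarrow> complex^'n^'n \<Rightarrow> complex^'n^'n \<Rightarrow> complex^'n^'n \<Rightarrow> complex^'n^'n"
where
  "ext_mBeta A B Y P Q =
     (LINT t:{0<..<1}|lborel.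
        mhyp1F1 A B (- ((1 / (t * (1 - t))) *\<^sub>R Y))
          ** rpow t (P - mat 1) ** rpow (1 - t) (Q - mat 1))"

definition ext_mhyp1F1 ::
  "complex^'n^'n \<Rightarrow> complex^'n^'n \<Rightarrow> complex^'n^'n \<Rightarrow> complex^'n^'n \<Rightarrow> complex^'n^'n \<Rightarrow> complex \<Rightarrow>
   complex^'n^'n"
where
  "ext_mhyp1F1 A B Y B1 C1 z =
     (\<Sum>n. ext_mBeta A B Y (B1 + mat (of_nat n)) (C1 - B1)
            ** matrix_inv (mBeta B1 (C1 - B1)) ** mat (z ^ n / fact n))"

text \<open>Matrix-valued functions of a complex variable are differentiated entrywise.\<close>

definition mat_holomorphic_on :: "(complex \<Rightarrow> complex^'n^'n) \<Rightarrow> complex set \<Rightarrow> bool" where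
  "mat_holomorphic_on F S \<longleftrightarrow> (\<forall>i j. (\<lambda>z. F z $ i $ j) holomorphic_on S)"

definition mat_nth_deriv :: "nat \<Rightarrow> (complex \<Rightarrow> complex^'n^'n) \<Rightarrow> complex \<Rightarrow> complex^'n^'n" where
  "mat_nth_deriv n F z = (\<chi> i j. (deriv ^^ n) (\<lambda>w. F w $ i $ j) z)"

end

theory Submission
  imports Defs "HOL-Computational_Algebra.Fundamental_Theorem_Algebra" "HOL-Real_Asymp.Real_Asymp"
begin

text \<open>
  The series is an exponential generating function \<open>\<Sum> a\<^sub>k z\<^sup>k / k!\<close> with bounded coefficients, so it is
  entire and differentiating it \<open>n\<close> times shifts the coefficients by \<open>n\<close>. Replacing \<open>(B\<^sub>1, C\<^sub>1)\<close> by
  \<open>(B\<^sub>1 + n, C\<^sub>1 + n)\<close> shifts the integrals \<open>ext_mBeta\<close> in the same way and changes the normalising factor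
  \<open>mBeta\<close> by \<open>mpoch B\<^sub>1 n ** matrix_inv (mpoch C\<^sub>1 n)\<close>, by the functional equation of the matrix Gamma
  function. That equation is an integration by parts, and the Gamma matrices are invertible because a
  nonzero kernel would contain an eigenvector of \<open>P\<close> with eigenvalue \<open>c\<close>, forcing \<open>Gamma c = 0\<close>.
\<close>

subsection \<open>Exponential generating functions\<close>

text \<open>The common scalar shape of the analysis: entries of \<open>mexp (s *\<^sub>R M)\<close>
  as functions of \<open>s\<close> and entries of \<open>ext_mhyp1F1\<close> as functions of
  \<open>z\<close> are both of this form.\<close>

definition expo_series :: "(nat \<Rightarrow> complex) \<Rightarrow> complex \<Rightarrow> complex" where
  "expo_series c w = (\<Sum>n. c n * w ^ n / fact n)"

lemma expo_series_summable:
  assumes "\<And>n. norm (c n) \<le> C * K ^ n" and "K \<ge> 0"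
  shows "summable (\<lambda>n. c n * w ^ n / fact n :: complex)"
proof (rule summable_comparison_test')
  show "summable (\<lambda>n. C * ((K * norm w) ^ n /\<^sub>R fact n))"
    by (intro summable_mult summable_exp_generic)
  show "norm (c n * w ^ n / fact n) \<le> C * ((K * norm w) ^ n /\<^sub>R fact n)" for n
  proof -
    have "norm (c n * w ^ n / fact n) = norm (c n) * norm w ^ n / fact n"
      by (simp add: norm_mult norm_divide norm_power)
    also have "\<dots> \<le> (C * K ^ n) * norm w ^ n / fact n"
      by (intro divide_right_mono mult_right_mono assms) auto
    finally show ?thesis by (simp add: power_mult_distrib field_simps)
  qed
qed

text \<open>The factor \<open>n + 1\<close> from termwise differentiation cancels against
  \<open>fact (n + 1)\<close>, so the derivative only shifts the coefficient sequence. Geometric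
  growth \<open>K ^ n\<close> is allowed because powers of a matrix grow that way.\<close>

lemma expo_series_has_field_derivative:
  assumes "\<And>n. norm (c n) \<le> C * K ^ n" and "K \<ge> 0"
  shows "(expo_series c has_field_derivative expo_series (\<lambda>n. c (Suc n)) w) (at w)"
proof -
  have "summable (\<lambda>n. c n / fact n * y ^ n)" for y
    using expo_series_summable[OF assms, of y] by simp
  note D = termdiffs_strong_converges_everywhere[OF this, of w]
  have "diffs (\<lambda>n. c n / fact n) = (\<lambda>n. c (Suc n) / fact n)"
    by (rule ext) (simp add: diffs_def field_simps del: of_nat_Suc)
  with D show ?thesis
    by (simp add: expo_series_def[abs_def])
qed

lemma expo_series_nth_deriv:
  assumes "\<And>n. norm (c n) \<le> C"
  shows "(deriv ^^ k) (expo_series c) = expo_series (\<lambda>n. c (n + k))"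
proof (induction k)
  case (Suc k)
  have "deriv (expo_series (\<lambda>n. c (n + k))) = expo_series (\<lambda>n. c (Suc n + k))"
    using assms
    by (intro ext DERIV_imp_deriv expo_series_has_field_derivative[where C = C and K = 1]) auto
  with Suc show ?case by simp
qed simp

subsection \<open>Matrix algebra\<close>

text \<open>A bilinear map between finite-dimensional spaces is bounded. The interpretation built on
  this supplies continuity, the product rule, and the exchange of products with sums and
  integrals.\<close>

lemma bounded_bilinear_matrix_mult:
  "bounded_bilinear ((**) :: complex^'n^'m \<Rightarrow> complex^'p^'n \<Rightarrow> complex^'p^'m)"
  unfolding bilinear_conv_bounded_bilinear[symmetric] bilinear_def
  by (auto intro!: linearI simp: matrix_add_ldistrib scalar_matrix_assoc matrix_scalar_ac)
     (simp add: matrix_matrix_mult_def vec_eq_iff sum.distrib distrib_right)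

interpretation matrix_mult: bounded_bilinear
  "(**) :: complex^'n^'m \<Rightarrow> complex^'p^'n \<Rightarrow> complex^'p^'m"
  by (rule bounded_bilinear_matrix_mult)

lemma bounded_linear_mat: "bounded_linear (mat :: complex \<Rightarrow> complex^'n^'n)"
  unfolding linear_conv_bounded_linear[symmetric]
  by (rule linearI) (auto simp: mat_def vec_eq_iff)

lemma bounded_linear_mult_vec: "bounded_linear (\<lambda>A. A *v v :: complex^'n)"
  unfolding linear_conv_bounded_linear[symmetric]
  by (rule linearI) (auto simp: matrix_vector_mult_def vec_eq_iff scaleR_sum_right sum.distrib algebra_simps)

lemma bounded_linear_entry: "bounded_linear (\<lambda>A::complex^'n^'m. A $ i $ j)"
  by (intro bounded_linear_compose[OF bounded_linear_vec_nth] bounded_linear_vec_nth)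

lemma mat_mult_nth [simp]: "(mat c ** A) $ i $ j = c * (A $ i $ j :: complex)"
  by (simp add: matrix_matrix_mult_def mat_def if_distrib if_distribR sum.delta cong: if_cong)

lemma mult_mat_nth [simp]: "(A ** mat c) $ i $ j = c * (A $ i $ j :: complex)"
  by (simp add: matrix_matrix_mult_def mat_def if_distrib if_distribR sum.delta' cong: if_cong)

lemma mat_commute: "A ** mat c = mat c ** (A :: complex^'n^'n)"
  by (simp add: vec_eq_iff)

lemma mat_mult_mat: "mat c ** mat d = (mat (c * d) :: complex^'n^'n)"
  by (simp add: vec_eq_iff) (simp add: mat_def)

lemma mat_add: "mat (c + d) = (mat c + mat d :: complex^'n^'n)"
  by (simp add: vec_eq_iff mat_def)

lemma mat_of_real_mult: "mat (of_real c) ** A = c *\<^sub>R (A :: complex^'n^'n)"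
  by (simp add: vec_eq_iff scaleR_conv_of_real[where 'a = complex])

lemma mat_mult_vec: "mat c *v v = c *s (v :: complex^'n)"
  by (simp add: matrix_vector_mult_def mat_def vec_eq_iff if_distrib if_distribR sum.delta cong: if_cong)

text \<open>The norm is Euclidean in the entries and \<open>mat c\<close> scales every entry by
  \<open>c\<close>. This gives an exact rule for complex scalars, which \<open>scaleR\<close> does
  not cover.\<close>

lemma norm_mat_mult: "norm (mat c ** A) = norm c * norm (A :: complex^'n^'n)"
proof -
  have "norm ((mat c ** A) $ i) = norm c * norm (A $ i)" for i
    unfolding norm_vec_def by (simp add: norm_mult L2_set_right_distrib)
  then show ?thesis
    unfolding norm_vec_def[of A] norm_vec_def[of "mat c ** A"]
    by (simp add: L2_set_right_distrib)
qed

section \<open>Commuting matrices and inverses\<close>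

text \<open>Input only, so goals remain plain equations; the closure rules below then work as
  introduction rules on them.\<close>

abbreviation (input) mcomm :: "complex^'n^'n \<Rightarrow> complex^'n^'n \<Rightarrow> bool" where
  "mcomm X Y \<equiv> X ** Y = Y ** X"

lemma mcomm_mult: "mcomm X Y \<Longrightarrow> mcomm X Z \<Longrightarrow> mcomm X (Y ** Z)"
  by (metis matrix_mul_assoc)

lemma mcomm_add: "mcomm X Y \<Longrightarrow> mcomm X Z \<Longrightarrow> mcomm X (Y + Z)"
  by (simp add: matrix_mult.add_left matrix_mult.add_right)

lemma mcomm_diff: "mcomm X Y \<Longrightarrow> mcomm X Z \<Longrightarrow> mcomm X (Y - Z)"
  by (simp add: matrix_mult.diff_left matrix_mult.diff_right)

lemma mcomm_scaleR: "mcomm X Y \<Longrightarrow> mcomm X (c *\<^sub>R Y)"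
  by (simp add: matrix_mult.scaleR_left matrix_mult.scaleR_right)

lemma mcomm_mpow: "mcomm X Y \<Longrightarrow> mcomm X (mpow Y n)"
  by (induction n) (auto intro: mcomm_mult)

lemma mcomm_mpoch: "mcomm X Y \<Longrightarrow> mcomm X (mpoch Y n)"
  by (induction n) (auto intro!: mcomm_mult mcomm_add simp: mat_commute)

lemma matrix_inv_works:
  assumes "invertible (A :: complex^'n^'n)"
  shows "A ** matrix_inv A = mat 1" "matrix_inv A ** A = mat 1"
  using someI_ex[OF assms[unfolded invertible_def]] by (simp_all add: matrix_inv_def)

lemma matrix_inv_unique:
  fixes A B :: "complex^'n^'n"
  assumes "A ** B = mat 1" "B ** A = mat 1"
  shows "matrix_inv A = B"
proof -
  have "invertible A" using assms by (auto simp: invertible_def)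
  then have "matrix_inv A = matrix_inv A ** (A ** B)" by (simp add: assms)
  also have "\<dots> = B" using matrix_inv_works(2)[OF \<open>invertible A\<close>] by (simp add: matrix_mul_assoc)
  finally show ?thesis .
qed

lemma mcomm_matrix_inv:
  assumes "mcomm X Y" "invertible Y"
  shows "mcomm X (matrix_inv Y)"
proof -
  have "X ** matrix_inv Y = matrix_inv Y ** (Y ** X) ** matrix_inv Y"
    using matrix_inv_works(2)[OF assms(2)] by (simp add: matrix_mul_assoc)
  also have "\<dots> = matrix_inv Y ** X ** (Y ** matrix_inv Y)"
    unfolding assms(1)[symmetric] by (simp add: matrix_mul_assoc)
  finally show ?thesis using matrix_inv_works(1)[OF assms(2)] by simp
qed

lemma matrix_inv_mult:
  fixes A B :: "complex^'n^'n"
  assumes "invertible A" "invertible B"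
  shows "matrix_inv (A ** B) = matrix_inv B ** matrix_inv A"
proof (rule matrix_inv_unique)
  have "(A ** B) ** (matrix_inv B ** matrix_inv A) = A ** (B ** matrix_inv B) ** matrix_inv A"
    by (simp add: matrix_mul_assoc)
  then show "(A ** B) ** (matrix_inv B ** matrix_inv A) = mat 1"
    using assms by (simp add: matrix_inv_works)
  have "(matrix_inv B ** matrix_inv A) ** (A ** B) = matrix_inv B ** (matrix_inv A ** A) ** B"
    by (simp add: matrix_mul_assoc)
  then show "(matrix_inv B ** matrix_inv A) ** (A ** B) = mat 1"
    using assms by (simp add: matrix_inv_works)
qed

lemma invertible_matrix_inv: "invertible A \<Longrightarrow> invertible (matrix_inv (A :: complex^'n^'n))"
  using matrix_inv_works invertible_def by blast

subsection \<open>The matrix exponential\<close>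

lemma mpow_scaleR: "mpow (s *\<^sub>R M) n = s ^ n *\<^sub>R mpow M n"
  by (induction n) (simp_all add: matrix_mult.scaleR_left matrix_mult.scaleR_right)

text \<open>\<open>K\<close> is the boundedness constant of the product and \<open>C\<close> the
  norm of the identity matrix, which need not be 1 in this norm. Both are uniform in
  \<open>M\<close> and \<open>n\<close>, as the growth bound for \<open>mexp\<close>
  requires.\<close>

lemma mpow_norm_bound:
  "\<exists>C\<ge>0. \<exists>K\<ge>0. \<forall>(M :: complex^'n^'n) n. norm (mpow M n) \<le> C * (K * norm M) ^ n"
proof -
  obtain K where K: "K > 0" "\<And>(A :: complex^'n^'n) (B :: complex^'n^'n). norm (A ** B) \<le> norm A * norm B * K"
    using matrix_mult.pos_bounded by blast
  have "norm (mpow M n) \<le> norm (mat 1 :: complex^'n^'n) * (K * norm M) ^ n" for M :: "complex^'n^'n" and n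
  proof (induction n)
    case (Suc n)
    have "norm (mpow M (Suc n)) \<le> norm (mpow M n) * (norm M * K)"
      using K(2)[of "mpow M n" M] by (simp add: mult.assoc)
    also have "\<dots> \<le> (norm (mat 1 :: complex^'n^'n) * (K * norm M) ^ n) * (norm M * K)"
      using K(1) by (intro mult_right_mono Suc) auto
    finally show ?case by (simp add: algebra_simps)
  qed simp
  then show ?thesis using K(1)
    by (intro exI[of _ "norm (mat 1 :: complex^'n^'n)"] exI[of _ K] conjI) auto
qed

lemma mexp_summable: "summable (\<lambda>n. (1 / fact n) *\<^sub>R mpow (M :: complex^'n^'n) n)"
  and mexp_bound: "\<exists>C\<ge>0. \<exists>K\<ge>0. \<forall>M :: complex^'n^'n. norm (mexp M) \<le> C * exp (K * norm M)"
proof -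
  obtain C K where CK: "C \<ge> 0" "K \<ge> 0" "\<And>(M :: complex^'n^'n) n. norm (mpow M n) \<le> C * (K * norm M) ^ n"
    using mpow_norm_bound[where 'n = 'n] by blast
  have s: "(\<lambda>n. C * ((K * norm M) ^ n /\<^sub>R fact n)) sums (C * exp (K * norm M))" for M :: "complex^'n^'n"
    by (intro sums_mult exp_converges)
  have b: "norm ((1 / fact n) *\<^sub>R mpow M n) \<le> C * ((K * norm M) ^ n /\<^sub>R fact n)" for M :: "complex^'n^'n" and n
    using divide_right_mono[OF CK(3)[of M n], of "fact n"] by (simp add: field_simps)
  show "summable (\<lambda>n. (1 / fact n) *\<^sub>R mpow M n)" for M :: "complex^'n^'n"
    by (rule summable_comparison_test'[OF sums_summable[OF s] b])
  have "norm (mexp M) \<le> C * exp (K * norm M)" for M :: "complex^'n^'n"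
    unfolding mexp_def by (rule norm_suminf_le[OF b sums_summable[OF s], unfolded sums_unique[OF s, symmetric]])
  then show "\<exists>C\<ge>0. \<exists>K\<ge>0. \<forall>M :: complex^'n^'n. norm (mexp M) \<le> C * exp (K * norm M)"
    using CK(1,2) by blast
qed

lemma mexp_sums: "(\<lambda>n. (1 / fact n) *\<^sub>R mpow (M :: complex^'n^'n) n) sums mexp M"
  unfolding mexp_def by (rule summable_sums[OF mexp_summable])

lemma mexp_0: "mexp 0 = (mat 1 :: complex^'n^'n)"
proof -
  have "(\<lambda>n. (1 / fact n) *\<^sub>R mpow (0 :: complex^'n^'n) n) = (\<lambda>n. if n = 0 then mat 1 else 0)"
    by (rule ext, rename_tac n, case_tac n) auto
  then show ?thesis
    using mexp_sums[of "0 :: complex^'n^'n"] sums_single[of 0 "\<lambda>_. mat 1 :: complex^'n^'n"]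
    by (metis (no_types, lifting) sums_unique2 sums_cong)
qed

lemma mcomm_mexp:
  assumes "mcomm X Y"
  shows "mcomm X (mexp Y)"
proof -
  have "(\<lambda>n. X ** ((1 / fact n) *\<^sub>R mpow Y n)) sums (X ** mexp Y)"
    by (rule bounded_linear.sums[OF matrix_mult.bounded_linear_right mexp_sums])
  moreover have "(\<lambda>n. ((1 / fact n) *\<^sub>R mpow Y n) ** X) sums (mexp Y ** X)"
    by (rule bounded_linear.sums[OF matrix_mult.bounded_linear_left mexp_sums])
  moreover have "X ** ((1 / fact n) *\<^sub>R mpow Y n) = ((1 / fact n) *\<^sub>R mpow Y n) ** X" for n
    by (intro mcomm_scaleR mcomm_mpow assms)
  ultimately show ?thesis by (simp add: sums_unique2)
qed

text \<open>Passes to a power series in a complex variable, evaluated at a real point, so that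
  complex termwise differentiation applies.\<close>

lemma mexp_entry: "mexp (s *\<^sub>R M) $ i $ j = expo_series (\<lambda>n. mpow M n $ i $ j) (of_real s)"
proof -
  have "(\<lambda>n. ((1 / fact n) *\<^sub>R mpow (s *\<^sub>R M) n) $ i $ j) sums (mexp (s *\<^sub>R M) $ i $ j)"
    by (rule bounded_linear.sums[OF bounded_linear_entry mexp_sums])
  from sums_unique[OF this] show ?thesis
    by (simp add: expo_series_def mpow_scaleR scaleR_conv_of_real[where 'a = complex] divide_inverse mult_ac)
qed

lemma has_vector_derivative_entrywise:
  assumes "\<And>i j. ((\<lambda>x. f x $ i $ j) has_vector_derivative f' $ i $ j) (at x)"
  shows "(f has_vector_derivative (f' :: complex^'n^'m)) (at x)"
proof -
  have "((\<lambda>x. f x $ i $ j \<bullet> b) has_derivative (\<lambda>h. h *\<^sub>R f' $ i $ j \<bullet> b)) (at x)" for i j b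
    using assms unfolding has_vector_derivative_def by (intro has_derivative_inner_left) auto
  then show ?thesis
    unfolding has_vector_derivative_def
    by (subst has_derivative_componentwise_within) (auto simp: Basis_vec_def inner_axis)
qed

lemma mexp_has_vector_derivative:
  fixes M :: "complex^'n^'n"
  shows "((\<lambda>s. mexp (s *\<^sub>R M)) has_vector_derivative M ** mexp (s *\<^sub>R M)) (at s)"
proof (rule has_vector_derivative_entrywise)
  fix i j
  obtain C K where CK: "C \<ge> 0" "K \<ge> 0" "\<And>(M :: complex^'n^'n) n. norm (mpow M n) \<le> C * (K * norm M) ^ n"
    using mpow_norm_bound[where 'n = 'n] by blast
  have "norm (mpow M n $ i $ j) \<le> C * (K * norm M) ^ n" for n
    using order_trans[OF Finite_Cartesian_Product.norm_nth_le
      order_trans[OF Finite_Cartesian_Product.norm_nth_le CK(3)]] .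
  then have D: "(expo_series (\<lambda>n. mpow M n $ i $ j) has_field_derivative
      expo_series (\<lambda>n. mpow M (Suc n) $ i $ j) (of_real s)) (at (of_real s))"
    by (rule expo_series_has_field_derivative) (use CK(2) in auto)
  \<comment> \<open>The shifted coefficients come from \<open>mpow M n ** M\<close>, so the
    derivative series is the exponential series multiplied by \<open>M\<close> on the right.\<close>
  have "(\<lambda>n. (((1 / fact n) *\<^sub>R mpow (s *\<^sub>R M) n) ** M) $ i $ j) sums ((mexp (s *\<^sub>R M) ** M) $ i $ j)"
    by (intro bounded_linear.sums[OF bounded_linear_entry] bounded_linear.sums[OF matrix_mult.bounded_linear_left] mexp_sums)
  then have "expo_series (\<lambda>n. mpow M (Suc n) $ i $ j) (of_real s) = (mexp (s *\<^sub>R M) ** M) $ i $ j"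
    by (simp add: sums_iff expo_series_def mpow_scaleR matrix_mult.scaleR_left scaleR_conv_of_real[where 'a = complex] divide_inverse mult_ac)
  also have "mexp (s *\<^sub>R M) ** M = M ** mexp (s *\<^sub>R M)"
    by (rule mcomm_mexp[symmetric]) (simp add: mcomm_scaleR)
  finally show "((\<lambda>x. mexp (x *\<^sub>R M) $ i $ j) has_vector_derivative (M ** mexp (s *\<^sub>R M)) $ i $ j) (at s)"
    using has_vector_derivative_real_field[OF D] by (simp add: mexp_entry)
qed

text \<open>The product of \<open>mexp (- (s *\<^sub>R M))\<close> with any solution has derivative
  zero, hence is constantly \<open>mat 1\<close>.\<close>

lemma mexp_ode_unique:
  fixes M :: "complex^'n^'n"
  assumes U: "\<And>s. (U has_vector_derivative M ** U s) (at s)" "U 0 = mat 1"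
  shows "U s = mexp (s *\<^sub>R M)"
proof -
  \<comment> \<open>Stated for an arbitrary solution because it is used twice: for the exponential
    itself, which gives its inverse, and for the given \<open>U\<close>.\<close>
  have *: "mexp (- (s *\<^sub>R M)) ** U s = mat 1"
    if U: "\<And>s. (U has_vector_derivative M ** U s) (at s)" and U0: "U 0 = mat 1" for U s
  proof -
    have "((\<lambda>s. mexp (s *\<^sub>R - M) ** U s) has_vector_derivative 0) (at s)" for s
    proof -
      have "((\<lambda>s. mexp (s *\<^sub>R - M) ** U s) has_vector_derivative
          mexp (s *\<^sub>R - M) ** (M ** U s) + (- M ** mexp (s *\<^sub>R - M)) ** U s) (at s)"
        by (intro matrix_mult.has_vector_derivative mexp_has_vector_derivative U)
      moreover have "- M ** mexp (s *\<^sub>R - M) = - (mexp (s *\<^sub>R - M) ** M)"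
      proof -
        have "mcomm M (s *\<^sub>R - M)"
          by (simp add: matrix_mult.scaleR_left matrix_mult.scaleR_right matrix_mult.minus_left matrix_mult.minus_right)
        then show ?thesis
          by (simp add: mcomm_mexp matrix_mult.minus_left)
      qed
      ultimately show ?thesis
        by (simp add: matrix_mult.minus_left matrix_mul_assoc)
    qed
    then obtain c where c: "\<And>s. mexp (s *\<^sub>R - M) ** U s = c"
      using has_vector_derivative_zero_constant[of UNIV "\<lambda>s. mexp (s *\<^sub>R - M) ** U s"]
      by auto
    from c[of 0] c[of s] show ?thesis by (simp add: U0 mexp_0)
  qed
  have inv: "mexp (- (s *\<^sub>R M)) ** mexp (s *\<^sub>R M) = mat 1" for s
    using *[of "\<lambda>s. mexp (s *\<^sub>R M)"] by (simp add: mexp_has_vector_derivative mexp_0)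
  have "U s = mexp (s *\<^sub>R M) ** mexp (- (s *\<^sub>R M)) ** U s"
    using inv[of "- s"] by simp
  also have "\<dots> = mexp (s *\<^sub>R M)"
    using *[OF U] by (simp add: matrix_mul_assoc[symmetric])
  finally show ?thesis .
qed

lemma has_vector_derivative_mat_exp:
  "((\<lambda>s. mat (exp (c * of_real s)) :: complex^'n^'n) has_vector_derivative mat c ** mat (exp (c * of_real s))) (at s)"
proof -
  have "((\<lambda>s. exp (c * of_real s)) has_vector_derivative c * exp (c * of_real s)) (at s)"
    by (auto intro!: derivative_eq_intros has_vector_derivative_real_field)
  from bounded_linear.has_vector_derivative[OF bounded_linear_mat this] show ?thesis
    by (simp add: mat_mult_mat)
qed

text \<open>Both sides solve the linear equation with matrix \<open>M + mat c\<close> and start at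
  \<open>mat 1\<close>; this is the addition formula for a scalar summand.\<close>

lemma mexp_add_mat:
  "mexp (s *\<^sub>R (M + mat c)) = mat (exp (c * of_real s)) ** mexp (s *\<^sub>R (M :: complex^'n^'n))"
proof (rule sym, rule mexp_ode_unique)
  fix s
  have "((\<lambda>s. mat (exp (c * of_real s)) ** mexp (s *\<^sub>R M)) has_vector_derivative
      mat (exp (c * of_real s)) ** (M ** mexp (s *\<^sub>R M)) + mat c ** mat (exp (c * of_real s)) ** mexp (s *\<^sub>R M)) (at s)"
    by (intro matrix_mult.has_vector_derivative mexp_has_vector_derivative has_vector_derivative_mat_exp)
  also have "mat (exp (c * of_real s)) ** (M ** mexp (s *\<^sub>R M)) = M ** (mat (exp (c * of_real s)) ** mexp (s *\<^sub>R M))"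
    unfolding matrix_mul_assoc mat_commute ..
  finally show "((\<lambda>s. mat (exp (c * of_real s)) ** mexp (s *\<^sub>R M)) has_vector_derivative
      (M + mat c) ** (mat (exp (c * of_real s)) ** mexp (s *\<^sub>R M))) (at s)"
    by (simp add: matrix_mult.add_left matrix_mul_assoc)
qed (simp add: mexp_0)

lemma mexp_eigenvector:
  assumes "M *v v = c *s v"
  shows "mexp (s *\<^sub>R M) *v v = exp (c * of_real s) *s (v :: complex^'n)"
proof -
  have p: "mpow M n *v v = c ^ n *s v" for n
    by (induction n) (simp_all add: matrix_vector_mul_assoc[symmetric] assms vector_scalar_commute vector_smult_assoc mult.commute)
  have "(mexp (s *\<^sub>R M) *v v) $ i = exp (c * of_real s) * v $ i" for i
  proof (rule sums_unique2)
    have "(\<lambda>n. (((1 / fact n) *\<^sub>R mpow (s *\<^sub>R M) n) *v v) $ i) sums ((mexp (s *\<^sub>R M) *v v) $ i)"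
      by (intro bounded_linear.sums[OF bounded_linear_vec_nth] bounded_linear.sums[OF bounded_linear_mult_vec] mexp_sums)
    moreover have "((1 / fact n) *\<^sub>R mpow (s *\<^sub>R M) n) *v v = (1 / fact n) *\<^sub>R s ^ n *\<^sub>R (c ^ n *s v)" for n
      by (simp only: mpow_scaleR p linear_scale[OF bounded_linear.linear[OF bounded_linear_mult_vec]])
    ultimately show "(\<lambda>n. (c * of_real s) ^ n /\<^sub>R fact n * v $ i) sums ((mexp (s *\<^sub>R M) *v v) $ i)"
      by (simp add: scaleR_conv_of_real[where 'a = complex] power_mult_distrib divide_inverse mult_ac)
    show "(\<lambda>n. (c * of_real s) ^ n /\<^sub>R fact n * v $ i) sums (exp (c * of_real s) * v $ i)"
      by (intro sums_mult2 exp_converges)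
  qed
  then show ?thesis by (simp add: vec_eq_iff)
qed

subsection \<open>Annihilating polynomials and eigenvectors\<close>

text \<open>The head factor stands on the right, next to whatever the product is applied to, so
  induction on the list peels off the factor that acts first.\<close>

primrec char_prod :: "complex^'n^'n \<Rightarrow> complex list \<Rightarrow> complex^'n^'n" where
  "char_prod M [] = mat 1"
| "char_prod M (c # cs) = char_prod M cs ** (M - mat c)"

definition eigenvalue :: "complex^'n^'n \<Rightarrow> complex \<Rightarrow> bool" where
  "eigenvalue M c \<longleftrightarrow> (\<exists>v. v \<noteq> 0 \<and> M *v v = c *s v)"

text \<open>Horner evaluation, written with \<open>**\<close> because the class multiplication of
  matrices is entrywise.\<close>

definition matrix_poly :: "complex^'n^'n \<Rightarrow> complex poly \<Rightarrow> complex^'n^'n" where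
  "matrix_poly M p = fold_coeffs (\<lambda>a X. mat a + M ** X) p 0"

lemma matrix_poly_pCons [simp]: "matrix_poly M (pCons a p) = mat a + M ** matrix_poly M p"
  by (cases "p = 0 \<and> a = 0") (auto simp: matrix_poly_def)

lemma matrix_poly_0 [simp]: "matrix_poly M 0 = 0"
  by (simp add: matrix_poly_def)

lemma matrix_poly_add: "matrix_poly M (p + q) = matrix_poly M p + matrix_poly M q"
  by (induction p q rule: poly_induct2) (simp_all add: mat_add matrix_mult.add_right)

lemma matrix_poly_smult: "matrix_poly M (smult c p) = mat c ** matrix_poly M p"
proof (induction p)
  case (pCons a p)
  have "M ** (mat c ** matrix_poly M p) = mat c ** (M ** matrix_poly M p)"
    by (simp add: matrix_mul_assoc mat_commute)
  with pCons show ?case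
    by (simp add: matrix_mult.add_right mat_mult_mat)
qed simp

lemma matrix_poly_sum: "matrix_poly M (sum f S) = (\<Sum>x\<in>S. matrix_poly M (f x))"
  by (induction S rule: infinite_finite_induct) (simp_all add: matrix_poly_add)

lemma matrix_poly_monom: "matrix_poly M (monom c n) = mat c ** mpow M n"
proof (induction n)
  case (Suc n)
  have "M ** (mat c ** mpow M n) = mat c ** (M ** mpow M n)"
    by (simp add: matrix_mul_assoc mat_commute)
  also have "M ** mpow M n = mpow M n ** M"
    by (intro mcomm_mpow) simp
  finally show ?case using Suc by (simp add: monom_Suc)
qed (simp add: monom_0)

lemma matrix_poly_linear_mult: "matrix_poly M ([:- c, 1:] * p) = (M - mat c) ** matrix_poly M p"
proof -
  have "matrix_poly M ([:- c, 1:] * p) = mat (- c) ** matrix_poly M p + M ** matrix_poly M p"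
    by (simp only: mult_pCons_left mult_zero_left pCons_0_0 add_0_right smult_1_left
        matrix_poly_add matrix_poly_smult matrix_poly_pCons) simp
  moreover have "mat (- c) = (- mat c :: complex^'a^'a)"
    by (simp add: vec_eq_iff mat_def)
  ultimately show ?thesis
    by (simp add: matrix_mult.diff_left matrix_mult.minus_left)
qed

lemma mcomm_char_prod: "mcomm X M \<Longrightarrow> mcomm X (char_prod M cs)"
  by (induction cs) (auto intro!: mcomm_mult mcomm_diff simp: mat_commute)

lemma char_prod_comm: "char_prod M cs ** (M - mat c) = (M - mat c) ** char_prod M cs"
  by (rule mcomm_char_prod[symmetric]) (simp add: matrix_mult.diff_left matrix_mult.diff_right mat_commute)

text \<open>The powers with exponent up to the real dimension of the matrix space are one too many
  to be independent; a real linear relation among them is the polynomial.\<close>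

lemma annihilating_poly_exists:
  fixes M :: "complex^'n^'n"
  shows "\<exists>p. p \<noteq> 0 \<and> matrix_poly M p = 0"
\<comment> \<open>Linear dependence speaks of sets and would miss repeated powers. If two powers
  coincide, the difference of their monomials serves instead.\<close>
proof (cases "inj_on (mpow M) {..DIM(complex^'n^'n)}")
  case True
  define S where "S = mpow M ` {..DIM(complex^'n^'n)}"
  have "card S > DIM(complex^'n^'n)" "finite S"
    using card_image[OF True] by (simp_all add: S_def)
  then have "dependent S" using dependent_biggerset by blast
  with \<open>finite S\<close> obtain u where u: "\<exists>v\<in>S. u v \<noteq> 0" "(\<Sum>v\<in>S. u v *\<^sub>R v) = 0"
    by (auto simp: dependent_finite)
  define p where "p = (\<Sum>k\<le>DIM(complex^'n^'n). monom (complex_of_real (u (mpow M k))) k)"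
  obtain k where k: "k \<le> DIM(complex^'n^'n)" "u (mpow M k) \<noteq> 0"
    using u(1) by (auto simp: S_def)
  have "coeff p k = of_real (u (mpow M k))"
    using k(1) by (simp add: p_def coeff_sum)
  with k(2) have "p \<noteq> 0" by auto
  moreover have "matrix_poly M p = (\<Sum>k\<le>DIM(complex^'n^'n). u (mpow M k) *\<^sub>R mpow M k)"
    by (simp add: p_def matrix_poly_sum matrix_poly_monom mat_of_real_mult)
  moreover have "\<dots> = (\<Sum>v\<in>S. u v *\<^sub>R v)"
    unfolding S_def by (simp only: sum.reindex[OF True] o_def)
  ultimately show ?thesis using u(2) by auto
next
  case False
  then obtain i j where ij: "i \<noteq> j" "mpow M i = mpow M j" by (auto simp: inj_on_def)
  define p :: "complex poly" where "p = monom 1 i + monom (- 1) j"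
  have "coeff p i = 1" using ij(1) by (simp add: p_def)
  then have "p \<noteq> 0" by auto
  moreover have "matrix_poly M p = mpow M i + mat (- 1) ** mpow M j"
    by (simp add: p_def matrix_poly_add matrix_poly_monom)
  then have "matrix_poly M p = 0"
    using ij(2) by (simp add: vec_eq_iff)
  ultimately show ?thesis by blast
qed

text \<open>By the fundamental theorem of algebra an annihilating polynomial splits into linear
  factors, and its nonzero leading coefficient cancels. The roots need not be eigenvalues
  yet.\<close>

lemma char_prod_zero_exists: "\<exists>cs. char_prod M cs = 0"
proof -
  obtain p where p: "p \<noteq> 0" "matrix_poly M p = 0" using annihilating_poly_exists by blast
  obtain r where r: "smult (lead_coeff p) (\<Prod>i<degree p. [:- r i, 1:]) = p"
    using complex_poly_decompose' .
  have "\<exists>cs. matrix_poly M (\<Prod>i<n. [:- r i, 1:]) = char_prod M cs" for n :: nat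
  proof (induction n)
    case 0
    have "matrix_poly M 1 = char_prod M []" by (simp add: one_pCons)
    then show ?case by (metis lessThan_0 prod.empty)
  next
    case (Suc n)
    then obtain cs where cs: "matrix_poly M (\<Prod>i<n. [:- r i, 1:]) = char_prod M cs" by blast
    have "matrix_poly M (\<Prod>i<Suc n. [:- r i, 1:]) = char_prod M (r n # cs)"
      using matrix_poly_linear_mult[of M "r n" "\<Prod>i<n. [:- r i, 1:]"]
      by (simp only: prod.lessThan_Suc mult.commute[of _ "[:- r n, 1:]"] cs char_prod.simps char_prod_comm)
    then show ?case by blast
  qed
  then obtain cs where cs: "matrix_poly M (\<Prod>i<degree p. [:- r i, 1:]) = char_prod M cs" by blast
  have "mat (lead_coeff p) ** char_prod M cs = 0"
    using arg_cong[OF r, of "matrix_poly M"] p(2) by (simp add: matrix_poly_smult cs)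
  then have "char_prod M cs = 0"
    using p(1) by (simp add: vec_eq_iff)
  then show ?thesis by blast
qed

text \<open>Any nonzero column of \<open>Z\<close> is an eigenvector.\<close>

lemma eigenvalueI_matrix:
  assumes "(M - mat c) ** Z = 0" "Z \<noteq> (0 :: complex^'n^'n)"
  shows "eigenvalue M c"
proof -
  obtain i j where ij: "Z $ i $ j \<noteq> 0" using assms(2) by (auto simp: vec_eq_iff)
  have "(Z *v axis j 1) $ i = Z $ i $ j"
    by (simp add: matrix_vector_mult_def axis_def if_distrib cong: if_cong)
  with ij have "Z *v axis j 1 \<noteq> 0" by (metis zero_index)
  moreover have "(M - mat c) *v (Z *v axis j 1) = 0"
    by (simp add: matrix_vector_mul_assoc assms(1))
  then have "M *v (Z *v axis j 1) = c *s (Z *v axis j 1)"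
    by (simp add: matrix_vector_mult_diff_rdistrib mat_mult_vec)
  ultimately show ?thesis unfolding eigenvalue_def by blast
qed

lemma char_prod_eigenvalues:
  fixes M X :: "complex^'n^'n"
  shows "char_prod M cs ** X = 0 \<Longrightarrow> \<exists>es. (\<forall>e\<in>set es. eigenvalue M e) \<and> char_prod M es ** X = 0"
proof (induction cs arbitrary: X)
  case Nil
  then show ?case by (intro exI[of _ "[]"]) auto
next
  case (Cons c cs)
  from Cons.prems have "char_prod M cs ** ((M - mat c) ** X) = 0"
    by (simp add: matrix_mul_assoc)
  from Cons.IH[OF this] obtain es
    where es: "\<forall>e\<in>set es. eigenvalue M e" "char_prod M es ** ((M - mat c) ** X) = 0" by blast
  show ?case
  proof (cases "char_prod M es ** X = 0")
    case False
    have "(M - mat c) ** (char_prod M es ** X) = 0"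
      using es(2) by (simp add: matrix_mul_assoc char_prod_comm)
    with False have "eigenvalue M c" by (intro eigenvalueI_matrix)
    with es show ?thesis by (intro exI[of _ "c # es"]) (auto simp: matrix_mul_assoc)
  qed (use es in blast)
qed

text \<open>Apply the factors of a vanishing product to \<open>v\<close> one after another: the last
  nonzero vector is an eigenvector of \<open>M\<close>, and commutation keeps each of them in the
  kernel of \<open>G\<close>.\<close>

lemma eigenvector_in_kernel:
  fixes G :: "complex^'n^'n"
  assumes "mcomm G M" "G *v v = 0" "v \<noteq> 0"
  shows "\<exists>c w. w \<noteq> 0 \<and> M *v w = c *s w \<and> G *v w = 0"
proof -
  obtain cs where "char_prod M cs = 0" using char_prod_zero_exists by blast
  then have "char_prod M cs *v v = 0" by simp
  with assms(2,3) show ?thesis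
  proof (induction cs arbitrary: v)
    case (Cons c cs)
    let ?w = "(M - mat c) *v v"
    show ?case
    proof (cases "?w = 0")
      case True
      then have "M *v v = c *s v" by (simp add: matrix_vector_mult_diff_rdistrib mat_mult_vec)
      with Cons.prems show ?thesis by blast
    next
      case False
      have "mcomm G (M - mat c)" using assms(1) by (intro mcomm_diff) (simp_all add: mat_commute)
      then have "G *v ?w = (M - mat c) *v (G *v v)"
        by (simp add: matrix_vector_mul_assoc)
      with Cons.prems have "G *v ?w = 0" by simp
      with Cons.IH[of ?w] Cons.prems False show ?thesis by (simp add: matrix_vector_mul_assoc)
    qed
  qed simp
qed

lemma invertible_iff_ker: "invertible (G :: complex^'n^'n) \<longleftrightarrow> (\<forall>v. G *v v = 0 \<longrightarrow> v = 0)"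
  unfolding invertible_left_inverse matrix_left_invertible_ker ..

subsection \<open>The matrix Gamma function\<close>

text \<open>Induction on the factors takes the place of a Jordan form. The derivative of
  \<open>exp (- c s) mexp (s M) X\<close> contains \<open>(M - mat c) ** X\<close>, which the
  induction hypothesis bounds; integrating from \<open>s\<close> to 0 bounds the function. The
  strict gap \<open>a < Re c\<close> prevents polynomial factors.\<close>

lemma mexp_decay_aux:
  fixes M X :: "complex^'n^'n"
  assumes "char_prod M cs ** X = 0" "\<And>c. c \<in> set cs \<Longrightarrow> a < Re c"
  shows "\<exists>C\<ge>0. \<forall>s\<le>0. norm (mexp (s *\<^sub>R M) ** X) \<le> C * exp (a * s)"
  using assms
proof (induction cs arbitrary: X)
  case Nil
  then show ?case by (intro exI[of _ 0]) auto
next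
  case (Cons c cs)
  define d where "d = Re c - a"
  have d: "d > 0" using Cons.prems(2)[of c] by (simp add: d_def)
  have "char_prod M cs ** ((M - mat c) ** X) = 0"
    using Cons.prems(1) by (simp add: matrix_mul_assoc)
  with Cons.IH Cons.prems(2) obtain C where C: "C \<ge> 0"
    "\<And>s. s \<le> 0 \<Longrightarrow> norm (mexp (s *\<^sub>R M) ** ((M - mat c) ** X)) \<le> C * exp (a * s)"
    by (metis list.set_intros(2))
  define h where "h s = mexp (s *\<^sub>R (M + mat (- c))) ** X" for s
  have mc: "M + mat (- c) = M - mat c" by (simp add: vec_eq_iff mat_def)
  have h_eq: "h s = mat (exp (- c * of_real s)) ** (mexp (s *\<^sub>R M) ** X)" for s
    unfolding h_def mexp_add_mat by (simp add: matrix_mul_assoc)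
  have norm_h: "norm (h s) = exp (- Re c * s) * norm (mexp (s *\<^sub>R M) ** X)" for s
    by (simp add: h_eq norm_mat_mult)
  define h' where "h' s = mexp (s *\<^sub>R (M + mat (- c))) ** ((M - mat c) ** X)" for s
  have h': "(h has_vector_derivative h' s) (at s)" for s
  proof -
    have "(h has_vector_derivative (M + mat (- c)) ** mexp (s *\<^sub>R (M + mat (- c))) ** X) (at s)"
      unfolding h_def
      by (intro bounded_linear.has_vector_derivative[OF matrix_mult.bounded_linear_left] mexp_has_vector_derivative)
    also have "(M + mat (- c)) ** mexp (s *\<^sub>R (M + mat (- c))) = mexp (s *\<^sub>R (M + mat (- c))) ** (M + mat (- c))"
      by (intro mcomm_mexp mcomm_scaleR) simp
    finally show ?thesis by (simp add: h'_def matrix_mul_assoc mc)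
  qed
  have h'_bound: "norm (h' s) \<le> C * exp (- d * s)" if "s \<le> 0" for s
  proof -
    have "norm (h' s) = exp (- Re c * s) * norm (mexp (s *\<^sub>R M) ** ((M - mat c) ** X))"
      unfolding h'_def mexp_add_mat by (simp add: matrix_mul_assoc[symmetric] norm_mat_mult)
    also have "\<dots> \<le> exp (- Re c * s) * (C * exp (a * s))"
      by (intro mult_left_mono C(2) that) simp
    also have "\<dots> = C * exp (- d * s)"
      by (simp add: d_def exp_add[symmetric] algebra_simps)
    finally show ?thesis .
  qed
  \<comment> \<open>\<open>norm X\<close> is the value of \<open>h\<close> at 0, and
    \<open>C / d\<close> comes from integrating \<open>C * exp (- d * u)\<close> over
    \<open>u\<close> from \<open>s\<close> to 0.\<close>
  define D where "D = norm X + C / d"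
  have "norm (mexp (s *\<^sub>R M) ** X) \<le> D * exp (a * s)" if s: "s \<le> 0" for s
  proof -
    have "norm (h 0 - h s) \<le> - (C / d) * exp (- d * 0) - (- (C / d) * exp (- d * s))"
    proof (cases "s = 0")
      case False
      show ?thesis
      proof (rule differentiable_bound_general[where f' = h' and \<phi>' = "\<lambda>s. C * exp (- d * s)"])
        show "s < 0" using s False by simp
        show "continuous_on {s..0} h"
          using h' by (meson continuous_at_imp_continuous_on has_vector_derivative_continuous)
        show "continuous_on {s..0} (\<lambda>s. - (C / d) * exp (- d * s))" by (intro continuous_intros)
        show "((\<lambda>s. - (C / d) * exp (- d * s)) has_vector_derivative C * exp (- d * x)) (at x)" for x
          unfolding has_real_derivative_iff_has_vector_derivative[symmetric]
          using d by (auto intro!: derivative_eq_intros)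
      qed (use h' h'_bound in auto)
    qed simp
    then have "norm (h 0 - h s) \<le> C / d * exp (- d * s)"
      using divide_nonneg_pos[OF C(1) d] by (simp add: algebra_simps)
    moreover have "norm (h s) \<le> norm (h 0) + norm (h 0 - h s)"
      by (metis norm_minus_commute norm_triangle_sub)
    moreover have "norm (h 0) \<le> norm X * exp (- d * s)"
    proof -
      have "- d * s \<ge> 0" using s d by (simp add: mult_nonneg_nonpos)
      then show ?thesis by (simp add: h_def mexp_0 mult_le_cancel_left1)
    qed
    ultimately have "norm (h s) \<le> D * exp (- d * s)"
      by (simp add: D_def algebra_simps)
    then have "exp (Re c * s) * norm (h s) \<le> exp (Re c * s) * (D * exp (- d * s))"
      by (intro mult_left_mono) auto
    moreover have "exp (Re c * s) * norm (h s) = norm (mexp (s *\<^sub>R M) ** X)"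
      unfolding norm_h by (simp add: mult.assoc[symmetric] exp_add[symmetric])
    moreover have "exp (Re c * s) * (D * exp (- d * s)) = D * exp (a * s)"
      by (simp add: d_def exp_add[symmetric] algebra_simps)
    ultimately show ?thesis by (simp only:)
  qed
  moreover have "D \<ge> 0" using C(1) d by (simp add: D_def)
  ultimately show ?case by blast
qed

lemma positive_stable_eigenvalue: "positive_stable M \<longleftrightarrow> (\<forall>c. eigenvalue M c \<longrightarrow> Re c > 0)"
  by (auto simp: positive_stable_def eigenvalue_def)

lemma mexp_decay:
  assumes "positive_stable M"
  obtains a C where "a > 0" "C \<ge> 0" "\<And>s. s \<le> 0 \<Longrightarrow> norm (mexp (s *\<^sub>R M)) \<le> C * exp (a * s)"
proof -
  obtain cs where "char_prod M cs = 0" using char_prod_zero_exists by blast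
  then have "char_prod M cs ** mat 1 = 0" by simp
  from char_prod_eigenvalues[OF this] obtain es
    where es: "\<And>e. e \<in> set es \<Longrightarrow> eigenvalue M e" "char_prod M es ** mat 1 = 0" by blast
  \<comment> \<open>Halving gives a strict gap below every real part; inserting 1 keeps
    \<open>Min\<close> meaningful when the list is empty.\<close>
  define a where "a = Min (insert 1 (Re ` set es)) / 2"
  have "0 < Min (insert 1 (Re ` set es))"
    using es(1) assms by (auto simp: positive_stable_eigenvalue)
  then have a: "a > 0" by (simp add: a_def)
  have "a < Re e" if "e \<in> set es" for e
  proof -
    have "2 * a \<le> Re e" using that by (simp add: a_def)
    with a show ?thesis by simp
  qed
  from mexp_decay_aux[OF es(2) this] a show thesis using that by auto
qed

section \<open>Matrix powers of a positive real\<close>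

lemma rpow_continuous_on: "continuous_on {0<..} (\<lambda>t. rpow t (M :: complex^'n^'n))"
proof -
  have "continuous_on UNIV (\<lambda>s. mexp (s *\<^sub>R M))"
    by (intro continuous_at_imp_continuous_on ballI has_vector_derivative_continuous[OF mexp_has_vector_derivative])
  then have "continuous_on {0<..} ((\<lambda>s. mexp (s *\<^sub>R M)) \<circ> ln)"
    by (intro continuous_on_compose continuous_intros) (auto intro: continuous_on_subset)
  then show ?thesis by (simp add: rpow_def o_def)
qed

lemma rpow_has_vector_derivative:
  fixes M :: "complex^'n^'n"
  assumes "t > 0"
  shows "((\<lambda>t. rpow t M) has_vector_derivative (1 / t) *\<^sub>R (M ** rpow t M)) (at t)"
proof -
  have "(ln has_vector_derivative 1 / t) (at t)"
    unfolding has_real_derivative_iff_has_vector_derivative[symmetric]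
    using assms by (auto intro!: derivative_eq_intros)
  from vector_diff_chain_at[OF this mexp_has_vector_derivative]
  show ?thesis by (simp add: rpow_def o_def)
qed

lemma rpow_add_of_nat:
  assumes "t > 0"
  shows "rpow t (M + mat (of_nat k)) = t ^ k *\<^sub>R rpow t (M :: complex^'n^'n)"
proof -
  have "exp (of_nat k * complex_of_real (ln t)) = of_real (t ^ k)"
    using assms by (simp add: exp_of_nat_mult exp_of_real)
  then show ?thesis
    by (simp only: rpow_def mexp_add_mat mat_of_real_mult)
qed

lemma rpow_diff_one:
  assumes "t > 0"
  shows "rpow t (M - mat 1) = (1 / t) *\<^sub>R rpow t (M :: complex^'n^'n)"
  using rpow_add_of_nat[OF assms, of "M - mat 1" 1] assms by simp

lemma mcomm_rpow: "mcomm X M \<Longrightarrow> mcomm X (rpow t M)"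
  unfolding rpow_def by (intro mcomm_mexp mcomm_scaleR)

text \<open>Spectral decay handles \<open>t \<le> 1\<close>, the crude growth bound of the
  exponential handles \<open>t > 1\<close>. Adding the two powers gives one majorant on the whole
  half-line.\<close>

lemma rpow_bound:
  fixes M :: "complex^'n^'n"
  assumes "positive_stable M"
  obtains a b C where "a > 0" "b > 0" "C \<ge> 0"
    "\<And>t. t > 0 \<Longrightarrow> norm (rpow t M) \<le> C * (t powr a + t powr b)"
proof -
  obtain a C where a: "a > 0" "C \<ge> 0" "\<And>s. s \<le> 0 \<Longrightarrow> norm (mexp (s *\<^sub>R M)) \<le> C * exp (a * s)"
    using mexp_decay[OF assms] by blast
  obtain D K where D: "D \<ge> 0" "K \<ge> 0" "\<And>M :: complex^'n^'n. norm (mexp M) \<le> D * exp (K * norm M)"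
    using mexp_bound[where 'n = 'n] by blast
  \<comment> \<open>The summand 1 makes the exponent strictly positive even if
    \<open>K * norm M\<close> is zero.\<close>
  define b where "b = K * norm M + 1"
  have "b > 0" using D(2) by (simp add: b_def add_nonneg_pos)
  have "norm (rpow t M) \<le> (C + D) * (t powr a + t powr b)" if t: "t > 0" for t
  proof (cases "t \<le> 1")
    case True
    then have "norm (rpow t M) \<le> C * t powr a"
      using a(3)[of "ln t"] t by (simp add: rpow_def powr_def)
    also have "\<dots> \<le> (C + D) * (t powr a + t powr b)"
      using a(2) D(1) by (intro mult_mono) auto
    finally show ?thesis .
  next
    case False
    then have t1: "ln t > 0" using t by simp
    then have "norm (rpow t M) \<le> D * exp (K * (ln t * norm M))"
      using D(3)[of "ln t *\<^sub>R M"] by (simp add: rpow_def)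
    also have "\<dots> \<le> D * exp (b * ln t)"
      using t1 D(1) by (intro mult_left_mono) (auto simp: b_def algebra_simps)
    also have "\<dots> = D * t powr b" using t by (simp add: powr_def)
    also have "\<dots> \<le> (C + D) * (t powr a + t powr b)"
      using a(2) D(1) by (intro mult_mono) auto
    finally show ?thesis .
  qed
  with a(1,2) D(1) \<open>b > 0\<close> show thesis using that[of a b "C + D"] by simp
qed

section \<open>The Gamma integral\<close>

text \<open>Integrability for \<open>lebesgue\<close> is the classical fact; Borel measurability of
  the continuous integrand transfers it to \<open>lborel\<close>.\<close>

lemma set_integrable_Gamma:
  assumes "Re z > 0"
  shows "set_integrable lborel {0<..} (\<lambda>t. complex_of_real t powr (z - 1) / of_real (exp t))"
proof -
  have "continuous_on {0<..} (\<lambda>t::real. complex_of_real t powr (z - 1) / of_real (exp t))"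
    by (intro continuous_intros) auto
  then have "set_borel_measurable lborel {0<..} (\<lambda>t. complex_of_real t powr (z - 1) / of_real (exp t))"
    unfolding set_borel_measurable_def measurable_lborel2 by (rule borel_measurable_continuous_on_indicator[rotated]) auto
  moreover have "set_integrable lebesgue {0<..} (\<lambda>t. complex_of_real t powr (z - 1) / of_real (exp t))"
    using absolutely_integrable_Gamma_integral'[OF assms] by simp
  ultimately show ?thesis
    unfolding set_integrable_def set_borel_measurable_def by (simp only: integrable_completion)
qed

lemma set_integrable_Gamma_real:
  assumes "x > 0"
  shows "set_integrable lborel {0<..} (\<lambda>t::real. exp (- t) * t powr (x - 1))"
proof -
  have "set_integrable lborel {0<..} (\<lambda>t. norm (complex_of_real t powr (complex_of_real x - 1) / of_real (exp t)))"
    by (rule set_integrable_norm[OF set_integrable_Gamma]) (use assms in simp)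
  also have "?this \<longleftrightarrow> ?thesis"
    by (rule set_integrable_cong) (auto simp: norm_divide norm_powr_real_powr exp_minus field_simps)
  finally show ?thesis .
qed

text \<open>\<open>P - mat 1\<close> need not be positive stable, so the bound is taken for
  \<open>rpow t P\<close> and divided by \<open>t\<close>. The majorant is then a combination of two
  real Gamma integrands.\<close>

lemma mGamma_integrable:
  fixes P :: "complex^'n^'n"
  assumes "positive_stable P"
  shows "set_integrable lborel {0<..} (\<lambda>t. exp (- t) *\<^sub>R rpow t (P - mat 1))"
proof -
  obtain a b C where *: "a > 0" "b > 0" "C \<ge> 0"
    "\<And>t. t > 0 \<Longrightarrow> norm (rpow t P) \<le> C * (t powr a + t powr b)"
    using rpow_bound[OF assms] by blast
  show ?thesis
  proof (rule set_integrable_bound)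
    show "set_integrable lborel {0<..}
        (\<lambda>t. C * (exp (- t) * t powr (a - 1) + exp (- t) * t powr (b - 1)))"
      by (intro set_integrable_mult_right set_integral_add set_integrable_Gamma_real *)
    have "continuous_on {0<..} (\<lambda>t. exp (- t) *\<^sub>R rpow t (P - mat 1))"
      by (intro continuous_intros rpow_continuous_on)
    then show "set_borel_measurable lborel {0<..} (\<lambda>t. exp (- t) *\<^sub>R rpow t (P - mat 1))"
      unfolding set_borel_measurable_def measurable_lborel2 by (rule borel_measurable_continuous_on_indicator[rotated]) auto
    have "norm (exp (- t) *\<^sub>R rpow t (P - mat 1)) \<le>
        norm (C * (exp (- t) * t powr (a - 1) + exp (- t) * t powr (b - 1)))" if t: "t > 0" for t
    proof -
      have "norm (exp (- t) *\<^sub>R rpow t (P - mat 1)) = exp (- t) / t * norm (rpow t P)"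
        using t by (simp add: rpow_diff_one divide_inverse)
      also have "\<dots> \<le> exp (- t) / t * (C * (t powr a + t powr b))"
        using t by (intro mult_left_mono *) auto
      also have "\<dots> = C * (exp (- t) * t powr (a - 1) + exp (- t) * t powr (b - 1))"
        using t by (simp add: powr_diff field_simps)
      finally show ?thesis by (rule order_trans) simp
    qed
    then show "AE t in lborel. t \<in> {0<..} \<longrightarrow> norm (exp (- t) *\<^sub>R rpow t (P - mat 1)) \<le>
        norm (C * (exp (- t) * t powr (a - 1) + exp (- t) * t powr (b - 1)))" by simp
  qed
qed

text \<open>Serves to move multiplication by a fixed matrix and application to a fixed vector
  through the matrix-valued integrals.\<close>

lemma set_integral_bounded_linear:
  fixes f :: "'a \<Rightarrow> 'b :: {banach, second_countable_topology}"
    and T :: "'b \<Rightarrow> 'c :: {banach, second_countable_topology}"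
  assumes "bounded_linear T" "set_integrable M S f"
  shows "set_integrable M S (\<lambda>x. T (f x))" "(LINT x:S|M. T (f x)) = T (LINT x:S|M. f x)"
proof -
  interpret bounded_linear T by fact
  have T: "indicator S x *\<^sub>R T (f x) = T (indicator S x *\<^sub>R f x)" for x by (simp add: scaleR)
  have int: "integrable M (\<lambda>x. indicator S x *\<^sub>R f x)" using assms(2) by (simp add: set_integrable_def)
  show "set_integrable M S (\<lambda>x. T (f x))"
    unfolding set_integrable_def T by (rule integrable_bounded_linear[OF assms(1) int])
  show "(LINT x:S|M. T (f x)) = T (LINT x:S|M. f x)"
    unfolding set_lebesgue_integral_def T by (rule integral_bounded_linear[OF assms(1) int])
qed

lemma mcomm_mGamma:
  assumes "positive_stable P" "mcomm X P"
  shows "mcomm X (mGamma P)"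
proof -
  have "mcomm X (exp (- t) *\<^sub>R rpow t (P - mat 1))" for t :: real
    using assms(2) by (intro mcomm_scaleR mcomm_rpow mcomm_diff) simp_all
  then show ?thesis
    using set_integral_bounded_linear(2)[OF matrix_mult.bounded_linear_right[of X] mGamma_integrable[OF assms(1)]]
      set_integral_bounded_linear(2)[OF matrix_mult.bounded_linear_left[of X] mGamma_integrable[OF assms(1)]]
    by (simp add: mGamma_def)
qed

text \<open>On an eigenvector the matrix integrand acts as the integrand of the scalar Gamma
  function at the eigenvalue.\<close>

lemma mGamma_eigenvector:
  fixes P :: "complex^'n^'n"
  assumes "positive_stable P" "P *v v = c *s v" "Re c > 0"
  shows "mGamma P *v v = Gamma c *s v"
proof -
  have eq: "(exp (- t) *\<^sub>R rpow t (P - mat 1)) *v v = (of_real t powr (c - 1) / of_real (exp t)) *s v"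
    if t: "t > 0" for t
  proof -
    have "(P - mat 1) *v v = (c - 1) *s v"
      using assms(2) by (simp add: matrix_vector_mult_diff_rdistrib vector_sub_rdistrib)
    from mexp_eigenvector[OF this, of "ln t"] t
    have "rpow t (P - mat 1) *v v = (of_real t powr (c - 1)) *s v"
      by (simp add: rpow_def powr_def Ln_of_real)
    then show ?thesis
      by (simp add: linear_scale[OF bounded_linear.linear[OF bounded_linear_mult_vec]] vec_eq_iff
          scaleR_conv_of_real[where 'a = complex] exp_minus divide_inverse mult_ac exp_of_real)
  qed
  have bl: "bounded_linear (\<lambda>x. x *s v)"
    unfolding linear_conv_bounded_linear[symmetric]
    by (rule linearI) (auto simp: vec_eq_iff algebra_simps)
  have "mGamma P *v v = (LINT t:{0<..}|lborel. (exp (- t) *\<^sub>R rpow t (P - mat 1)) *v v)"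
    unfolding mGamma_def
    by (rule set_integral_bounded_linear(2)[OF bounded_linear_mult_vec mGamma_integrable[OF assms(1)], symmetric])
  also have "\<dots> = (LINT t:{0<..}|lborel. (of_real t powr (c - 1) / of_real (exp t)) *s v)"
    by (rule set_lebesgue_integral_cong) (auto simp: eq)
  also have "\<dots> = (LINT t:{0<..}|lborel. of_real t powr (c - 1) / of_real (exp t)) *s v"
    by (rule set_integral_bounded_linear(2)[OF bl set_integrable_Gamma[OF assms(3)]])
  also have "(LINT t:{0<..}|lborel. of_real t powr (c - 1) / of_real (exp t)) = Gamma c"
    using set_borel_integral_eq_integral(2)[OF set_integrable_Gamma[OF assms(3)]]
      Gamma_integral_complex'[OF assms(3)] by (simp add: integral_unique)
  finally show ?thesis .
qed

lemma invertible_mGamma: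
  assumes "positive_stable P"
  shows "invertible (mGamma P)"
  unfolding invertible_iff_ker
proof (intro allI impI, rule ccontr)
  fix v assume "mGamma P *v v = 0" "v \<noteq> 0"
  moreover have "mcomm (mGamma P) P"
    by (rule mcomm_mGamma[symmetric]) (use assms in auto)
  ultimately obtain c w where w: "w \<noteq> 0" "P *v w = c *s w" "mGamma P *v w = 0"
    using eigenvector_in_kernel by blast
  then have c: "Re c > 0" using assms by (auto simp: positive_stable_def)
  \<comment> \<open>The totalised \<open>Gamma\<close> is zero only at its poles, the nonpositive
    integers, which \<open>Re c > 0\<close> excludes.\<close>
  then have "Gamma c \<noteq> 0" by (auto simp: Gamma_eq_zero_iff elim!: nonpos_Ints_cases)
  with mGamma_eigenvector[OF assms w(2) c] w show False by simp
qed

lemma eigenvalue_add_mat: "eigenvalue (M + mat d) c \<longleftrightarrow> eigenvalue M (c - d)"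
  by (simp add: eigenvalue_def matrix_vector_mult_add_rdistrib mat_mult_vec vector_sub_rdistrib eq_diff_eq)

lemma positive_stable_add_of_nat:
  "positive_stable M \<Longrightarrow> positive_stable (M + mat (of_nat k))"
  unfolding positive_stable_eigenvalue eigenvalue_add_mat
  by (metis (no_types) add.commute add_nonneg_pos diff_add_cancel of_nat_0_le_iff plus_complex.simps(1) complex_Re_of_nat)

lemma invertible_positive_stable:
  assumes "positive_stable M"
  shows "invertible M"
  unfolding invertible_iff_ker
proof (intro allI impI, rule ccontr)
  fix v assume "M *v v = 0" "v \<noteq> 0"
  then have "M *v v = 0 *s v" by simp
  with assms \<open>v \<noteq> 0\<close> show False unfolding positive_stable_def by (metis less_irrefl zero_complex.simps(1))
qed

lemma invertible_mat_1: "invertible (mat 1 :: complex^'n^'n)"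
  unfolding invertible_def by (metis matrix_mul_lid)

lemma invertible_mpoch: "positive_stable M \<Longrightarrow> invertible (mpoch M n)"
proof (induction n)
  case (Suc n)
  then show ?case
    by (simp add: invertible_mult invertible_positive_stable positive_stable_add_of_nat)
qed (simp add: invertible_mat_1)

lemma mGamma_add_one:
  fixes P :: "complex^'n^'n"
  assumes "positive_stable P"
  shows "mGamma (P + mat 1) = P ** mGamma P"
proof -
  \<comment> \<open>\<open>F\<close> plays two roles: it is the integrand of
    \<open>mGamma (P + mat 1)\<close>, and its derivative is \<open>P ** g t - F t\<close>, so
    integrating that derivative compares the two Gamma integrals.\<close>
  define F where "F t = exp (- t) *\<^sub>R rpow t P" for t
  define g where "g t = exp (- t) *\<^sub>R rpow t (P - mat 1)" for t
  have F_eq: "exp (- t) *\<^sub>R rpow t (P + mat 1 - mat 1) = F t" for t by (simp add: F_def)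
  have "positive_stable (P + mat 1)" using positive_stable_add_of_nat[OF assms, of 1] by simp
  from mGamma_integrable[OF this] have intF: "set_integrable lborel {0<..} F"
    by (simp only: F_eq)
  have intg: "set_integrable lborel {0<..} g"
    using mGamma_integrable[OF assms] by (simp only: g_def[abs_def])
  note Pg = set_integral_bounded_linear[OF matrix_mult.bounded_linear_right[of P] intg]
  have F': "(F has_vector_derivative P ** g t - F t) (at t)" if "t > 0" for t
  proof -
    have "((\<lambda>t. exp (- t)) has_vector_derivative - exp (- t)) (at t)"
      unfolding has_real_derivative_iff_has_vector_derivative[symmetric]
      by (auto intro!: derivative_eq_intros)
    then have "(F has_vector_derivative exp (- t) *\<^sub>R ((1 / t) *\<^sub>R (P ** rpow t P)) + (- exp (- t)) *\<^sub>R rpow t P) (at t)"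
      unfolding F_def
      by (intro bounded_bilinear.has_vector_derivative[OF bounded_bilinear_scaleR] rpow_has_vector_derivative that)
    then show ?thesis
      using that by (simp add: g_def F_def rpow_diff_one matrix_mult.scaleR_right)
  qed
  obtain a b C where *: "a > 0" "b > 0" "C \<ge> 0"
    "\<And>t. t > 0 \<Longrightarrow> norm (rpow t P) \<le> C * (t powr a + t powr b)"
    using rpow_bound[OF assms] by blast
  \<comment> \<open>Removes both boundary terms: the positive exponents force the limit zero at 0,
    the factor \<open>exp (- t)\<close> forces it at infinity.\<close>
  define \<phi> where "\<phi> t = C * (exp (- t) * t powr a + exp (- t) * t powr b)" for t :: real
  have Fb: "norm (F t) \<le> \<phi> t" if "t > 0" for t
    using mult_left_mono[OF *(4)[OF that], of "exp (- t)"] by (simp add: F_def \<phi>_def algebra_simps)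
  have "((\<lambda>t::real. exp (- t) * t powr c) \<longlongrightarrow> 0) (at_right 0)" if "c > 0" for c
    using that by real_asymp
  then have "(\<phi> \<longlongrightarrow> C * (0 + 0)) (at_right 0)"
    unfolding \<phi>_def using *(1,2) by (intro tendsto_intros) auto
  moreover have "\<forall>\<^sub>F t in at_right 0. norm (F t) \<le> \<phi> t"
    by (rule eventually_mono[OF eventually_at_right_less]) (rule Fb)
  ultimately have F0: "(F \<longlongrightarrow> 0) (at_right 0)"
    by (auto intro: Lim_null_comparison)
  have "((\<lambda>t::real. exp (- t) * t powr c) \<longlongrightarrow> 0) at_top" if "c > 0" for c
    using that by real_asymp
  then have "(\<phi> \<longlongrightarrow> C * (0 + 0)) at_top"
    unfolding \<phi>_def using *(1,2) by (intro tendsto_intros) auto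
  moreover have "\<forall>\<^sub>F t in at_top. norm (F t) \<le> \<phi> t"
    by (auto intro!: Fb eventually_mono[OF eventually_gt_at_top[of 0]])
  ultimately have Finf: "(F \<longlongrightarrow> 0) at_top"
    by (auto intro: Lim_null_comparison)
  have einf: "einterval 0 \<infinity> = {0<..}" by (auto simp: einterval_def)
  have "(LBINT t=0..\<infinity>. P ** g t - F t) = 0 - 0"
  proof (rule interval_integral_FTC_integrable)
    show "(F has_vector_derivative P ** g t - F t) (at t)" if "0 < ereal t" for t
      using that by (intro F') simp
    show "isCont (\<lambda>t. P ** g t - F t) t" if "0 < ereal t" for t
    proof -
      have "continuous_on {0<..} (\<lambda>t. P ** g t - F t)"
        unfolding g_def F_def
        by (intro continuous_intros matrix_mult.continuous_on rpow_continuous_on)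
      then show ?thesis using that by (simp add: continuous_on_eq_continuous_at)
    qed
    show "set_integrable lborel (einterval 0 \<infinity>) (\<lambda>t. P ** g t - F t)"
      unfolding einf by (intro set_integral_diff Pg intF)
    show "((F \<circ> real_of_ereal) \<longlongrightarrow> 0) (at_right 0)"
      using F0 by (simp add: zero_ereal_def ereal_tendsto_simps)
    show "((F \<circ> real_of_ereal) \<longlongrightarrow> 0) (at_left \<infinity>)"
      using Finf by (simp add: ereal_tendsto_simps)
  qed auto
  then have "(LINT t:{0<..}|lborel. P ** g t - F t) = 0"
    by (simp add: interval_lebesgue_integral_def einf)
  then have "(LINT t:{0<..}|lborel. P ** g t) = (LINT t:{0<..}|lborel. F t)"
    using set_integral_diff(2)[OF Pg(1) intF] by simp
  then have "P ** (LINT t:{0<..}|lborel. g t) = (LINT t:{0<..}|lborel. F t)"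
    by (simp only: Pg(2))
  then show ?thesis
    by (simp only: mGamma_def F_eq g_def)
qed

lemma mGamma_add_of_nat:
  assumes "positive_stable P"
  shows "mGamma (P + mat (of_nat n)) = mpoch P n ** mGamma P"
proof (induction n)
  case (Suc n)
  have "mGamma (P + mat (of_nat (Suc n))) = mGamma (P + mat (of_nat n) + mat 1)"
    by (simp add: mat_add add_ac)
  also have "\<dots> = (P + mat (of_nat n)) ** (mpoch P n ** mGamma P)"
    by (simp add: mGamma_add_one positive_stable_add_of_nat assms Suc)
  \<comment> \<open>The functional equation puts the new factor on the left, \<open>mpoch\<close> on
    the right; both are polynomials in \<open>P\<close>, so they commute.\<close>
  also have "(P + mat (of_nat n)) ** (mpoch P n ** mGamma P) = mpoch P (Suc n) ** mGamma P"
    using mcomm_mpoch[of "P + mat (of_nat n)" P n]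
    by (simp add: matrix_mul_assoc matrix_mult.add_left matrix_mult.add_right mat_commute)
  finally show ?case .
qed simp

subsection \<open>The Beta matrices\<close>

text \<open>The shift multiplies \<open>mGamma P\<close> by \<open>mpoch P k\<close> and
  \<open>mGamma (P + Q)\<close> by \<open>mpoch (P + Q) k\<close>, while \<open>mGamma Q\<close>
  stays. Since \<open>P\<close> and \<open>Q\<close> commute, these factors can be gathered to the
  left of \<open>mBeta P Q\<close>, where the inverse of the shifted Beta matrix cancels
  them.\<close>

lemma matrix_inv_mBeta_shift:
  fixes P Q :: "complex^'n^'n"
  assumes P: "positive_stable P" and Q: "positive_stable Q" and PQ: "positive_stable (P + Q)"
    and comm: "mcomm P Q"
  shows "matrix_inv (mBeta (P + mat (of_nat k)) Q) ** mpoch P k ** matrix_inv (mpoch (P + Q) k)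
    = matrix_inv (mBeta P Q)"
proof -
  let ?R = "P + Q"
  have cR: "mcomm P ?R" "mcomm Q ?R"
    using comm by (simp_all add: matrix_mult.add_left matrix_mult.add_right)
  define X where "X = mpoch P k ** matrix_inv (mpoch ?R k)"
  have inv: "invertible (mGamma P)" "invertible (mGamma Q)" "invertible (mGamma ?R)"
    "invertible (mpoch P k)" "invertible (mpoch ?R k)"
    using P Q PQ by (simp_all add: invertible_mGamma invertible_mpoch)
  have "mcomm (mpoch ?R k) P" "mcomm (mpoch ?R k) Q" "mcomm (mpoch ?R k) ?R"
    by (rule mcomm_mpoch[symmetric]; use cR in simp)+
  then have c: "mcomm (mpoch ?R k) (mGamma P ** mGamma Q ** matrix_inv (mGamma ?R))"
    using P Q PQ inv by (intro mcomm_mult mcomm_matrix_inv mcomm_mGamma)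
  have shift: "P + mat (of_nat k) + Q = ?R + mat (of_nat k)" by simp
  have "mBeta (P + mat (of_nat k)) Q
      = mpoch P k ** (mGamma P ** mGamma Q ** matrix_inv (mGamma ?R)) ** matrix_inv (mpoch ?R k)"
    unfolding mBeta_def shift using P PQ inv by (simp add: mGamma_add_of_nat matrix_inv_mult matrix_mul_assoc)
  also have "\<dots> = X ** mBeta P Q"
    using mcomm_matrix_inv[OF c[symmetric] inv(5)]
    by (simp add: X_def mBeta_def matrix_mul_assoc[symmetric])
  finally have eq: "mBeta (P + mat (of_nat k)) Q = X ** mBeta P Q" .
  have "invertible (mBeta P Q)" "invertible X"
    using inv by (simp_all add: mBeta_def X_def invertible_mult invertible_matrix_inv)
  then have "matrix_inv (mBeta (P + mat (of_nat k)) Q) ** X = matrix_inv (mBeta P Q)"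
    unfolding eq by (simp add: matrix_inv_mult matrix_inv_works matrix_mul_assoc[symmetric])
  then show ?thesis by (simp add: X_def matrix_mul_assoc)
qed

text \<open>No estimate of the kernel is needed: the \<open>k\<close>-th integrand is \<open>t ^ k\<close> times the zeroth one.
  Either some of these integrands is integrable, and then the integrals are eventually dominated by one
  of them, or none is, and then all integrals have the junk value \<open>0\<close>.\<close>

lemma ext_mBeta_bounded:
  fixes A B Y P Q :: "complex^'n^'n"
  shows "\<exists>K. \<forall>k. norm (ext_mBeta A B Y (P + mat (of_nat k)) Q) \<le> K"
proof -
  define f where "f k t = mhyp1F1 A B (- ((1 / (t * (1 - t))) *\<^sub>R Y))
    ** rpow t (P + mat (of_nat k) - mat 1) ** rpow (1 - t) (Q - mat 1)" for k t
  have E: "ext_mBeta A B Y (P + mat (of_nat k)) Q = (LINT t:{0<..<1}|lborel. f k t)" for k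
    by (simp add: ext_mBeta_def f_def)
  have shift: "f (j + k) t = t ^ k *\<^sub>R f j t" if "t > 0" for j k t
  proof -
    have "P + mat (of_nat (j + k)) - mat 1 = (P + mat (of_nat j) - mat 1) + mat (of_nat k)"
      by (simp add: mat_add)
    then show ?thesis
      using that by (simp only: f_def rpow_add_of_nat matrix_mult.scaleR_left matrix_mult.scaleR_right)
  qed
  show ?thesis
  proof (cases "\<exists>N. set_integrable lborel {0<..<1} (f N)")
    case True
    then obtain N where N: "set_integrable lborel {0<..<1} (f N)" by blast
    define I where "I = (LINT t:{0<..<1}|lborel. norm (f N t))"
    have large: "norm (LINT t:{0<..<1}|lborel. f (N + k) t) \<le> I" for k
    proof -
      have le: "norm (f (N + k) t) \<le> norm (f N t)" if "t \<in> {0<..<1}" for t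
        using that by (simp add: shift mult_left_le_one_le power_le_one)
      \<comment> \<open>Measurability is inherited from the integrable \<open>f N\<close> through
        the factor \<open>t ^ k\<close>, without looking into the hypergeometric kernel.\<close>
      have meas: "set_borel_measurable lborel {0<..<1} (f (N + k))"
      proof -
        have "(\<lambda>t. t ^ k *\<^sub>R (indicator {0<..<1} t *\<^sub>R f N t)) \<in> borel_measurable lborel"
          using N unfolding set_integrable_def
          by (intro borel_measurable_scaleR[OF _ borel_measurable_integrable]) auto
        also have "(\<lambda>t. t ^ k *\<^sub>R (indicator {0<..<1} t *\<^sub>R f N t))
            = (\<lambda>t. indicator {0<..<1} t *\<^sub>R f (N + k) t)"
          by (auto simp: fun_eq_iff shift indicator_def)
        finally show ?thesis unfolding set_borel_measurable_def .
      qed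
      have int: "set_integrable lborel {0<..<1} (f (N + k))"
        by (rule set_integrable_bound[OF N meas]) (use le in auto)
      have "norm (LINT t:{0<..<1}|lborel. f (N + k) t) \<le> (LINT t:{0<..<1}|lborel. norm (f (N + k) t))"
        by (rule set_integral_norm_bound[OF int])
      also have "\<dots> \<le> I"
        unfolding I_def by (rule set_integral_mono[OF set_integrable_norm[OF int] set_integrable_norm[OF N] le])
      finally show ?thesis .
    qed
    have "norm (ext_mBeta A B Y (P + mat (of_nat k)) Q)
        \<le> I + (\<Sum>k<N. norm (ext_mBeta A B Y (P + mat (of_nat k)) Q))" for k
    proof (cases "k < N")
      case True
      have "norm (ext_mBeta A B Y (P + mat (of_nat k)) Q)
          \<le> (\<Sum>k<N. norm (ext_mBeta A B Y (P + mat (of_nat k)) Q))"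
        using True by (intro member_le_sum) auto
      moreover have "I \<ge> 0" using order_trans[OF norm_ge_zero large[of 0]] .
      ultimately show ?thesis by simp
    next
      case False
      then have "norm (ext_mBeta A B Y (P + mat (of_nat k)) Q) \<le> I"
        using large[of "k - N"] by (simp add: E)
      then show ?thesis by (simp add: add_increasing2 sum_nonneg)
    qed
    then show ?thesis by blast
  next
    case False
    then have "ext_mBeta A B Y (P + mat (of_nat k)) Q = 0" for k
      unfolding E set_lebesgue_integral_def set_integrable_def by (intro not_integrable_integral_eq) auto
    then show ?thesis by (intro exI[of _ 0]) simp
  qed
qed

section \<open>The extended confluent hypergeometric series\<close>

text \<open>Boundedness of the \<open>ext_mBeta\<close> integrals, times a fixed matrix, lets the
  exponential series dominate. The matrix form of the sum is for the parameter shift, the entrywise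
  form for differentiation.\<close>

lemma ext_mhyp1F1_sums:
  fixes A B Y P R :: "complex^'n^'n"
  defines "a \<equiv> \<lambda>k. ext_mBeta A B Y (P + mat (of_nat k)) (R - P) ** matrix_inv (mBeta P (R - P))"
  shows "\<exists>C. \<forall>k i j. norm (a k $ i $ j) \<le> C"
    and "(\<lambda>k. a k ** mat (z ^ k / fact k)) sums ext_mhyp1F1 A B Y P R z"
    and "ext_mhyp1F1 A B Y P R z $ i $ j = expo_series (\<lambda>k. a k $ i $ j) z"
proof -
  obtain K where K: "\<And>k. norm (ext_mBeta A B Y (P + mat (of_nat k)) (R - P)) \<le> K"
    using ext_mBeta_bounded by blast
  obtain L where L: "L > 0" "\<And>(A :: complex^'n^'n). norm (A ** matrix_inv (mBeta P (R - P))) \<le> norm A * L"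
    using bounded_linear.pos_bounded[OF matrix_mult.bounded_linear_left] by blast
  have aKL: "norm (a k) \<le> K * L" for k
    unfolding a_def using L(2) K mult_right_mono[OF K less_imp_le[OF L(1)]] order_trans by blast
  have entry: "norm (a k $ i $ j) \<le> K * L" for k i j
    using order_trans[OF Finite_Cartesian_Product.norm_nth_le
      order_trans[OF Finite_Cartesian_Product.norm_nth_le aKL]] .
  then show "\<exists>C. \<forall>k i j. norm (a k $ i $ j) \<le> C" by blast
  have "summable (\<lambda>k. a k ** mat (z ^ k / fact k))"
  proof (rule summable_comparison_test')
    show "summable (\<lambda>k. (K * L) * (norm z ^ k /\<^sub>R fact k))"
      by (intro summable_mult summable_exp_generic)
    show "norm (a k ** mat (z ^ k / fact k)) \<le> (K * L) * (norm z ^ k /\<^sub>R fact k)" for k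
    proof -
      have "norm (a k ** mat (z ^ k / fact k)) = norm (a k) * (norm z ^ k /\<^sub>R fact k)"
        by (simp add: mat_commute norm_mat_mult norm_mult norm_inverse norm_divide norm_power divide_inverse_commute mult.commute)
      also have "\<dots> \<le> (K * L) * (norm z ^ k /\<^sub>R fact k)"
        by (intro mult_right_mono aKL) simp
      finally show ?thesis .
    qed
  qed
  then show S: "(\<lambda>k. a k ** mat (z ^ k / fact k)) sums ext_mhyp1F1 A B Y P R z"
    by (simp add: ext_mhyp1F1_def a_def summable_sums)
  show "ext_mhyp1F1 A B Y P R z $ i $ j = expo_series (\<lambda>k. a k $ i $ j) z"
    using sums_unique[OF bounded_linear.sums[OF bounded_linear_entry S]]
    by (simp add: expo_series_def mult_ac)
qed

text \<open>The difference \<open>R - P\<close> survives the joint shift, so only the first argument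
  of \<open>ext_mBeta\<close> moves, and it moves exactly as the index does. The Pochhammer factors
  repair the normalising Beta matrix.\<close>

lemma ext_mhyp1F1_shift:
  fixes A B Y P R :: "complex^'n^'n"
  assumes P: "positive_stable P" and R: "positive_stable R" and RP: "positive_stable (R - P)"
    and comm: "mcomm P R"
  shows "(\<lambda>m. ext_mBeta A B Y (P + mat (of_nat (m + k))) (R - P) ** matrix_inv (mBeta P (R - P))
            ** mat (z ^ m / fact m))
    sums (ext_mhyp1F1 A B Y (P + mat (of_nat k)) (R + mat (of_nat k)) z
            ** mpoch P k ** matrix_inv (mpoch R k))"
proof -
  let ?E = "\<lambda>m. ext_mBeta A B Y (P + mat (of_nat k) + mat (of_nat m)) (R - P)"
  let ?b = "matrix_inv (mBeta (P + mat (of_nat k)) (R - P))"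
  have "(\<lambda>m. ?E m ** ?b ** mat (z ^ m / fact m)
            ** (mpoch P k ** matrix_inv (mpoch R k)))
    sums (ext_mhyp1F1 A B Y (P + mat (of_nat k)) (R + mat (of_nat k)) z
            ** (mpoch P k ** matrix_inv (mpoch R k)))"
    using ext_mhyp1F1_sums(2)[of A B Y "P + mat (of_nat k)" "R + mat (of_nat k)" z]
    by (intro bounded_linear.sums[OF matrix_mult.bounded_linear_left]) simp
  moreover have "?E m ** ?b ** mat (z ^ m / fact m) ** (mpoch P k ** matrix_inv (mpoch R k))
      = ext_mBeta A B Y (P + mat (of_nat (m + k))) (R - P) ** matrix_inv (mBeta P (R - P)) ** mat (z ^ m / fact m)"
    for m
  proof -
    have "mcomm P (R - P)" using comm by (intro mcomm_diff) simp_all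
    then have b: "?b ** mpoch P k ** matrix_inv (mpoch R k) = matrix_inv (mBeta P (R - P))"
      using matrix_inv_mBeta_shift[of P "R - P" k] P R RP by simp
    \<comment> \<open>Only the scalar matrix changes place; nothing is commuted past
      \<open>?E m\<close>, whose kernel need not commute with the other factors.\<close>
    have "?E m ** ?b ** mat (z ^ m / fact m) ** (mpoch P k ** matrix_inv (mpoch R k))
        = ?E m ** (?b ** mpoch P k ** matrix_inv (mpoch R k)) ** mat (z ^ m / fact m)"
      by (simp add: matrix_mul_assoc mat_commute)
    then show ?thesis unfolding b by (simp add: mat_add add_ac)
  qed
  ultimately show ?thesis by (simp add: matrix_mul_assoc)
qed

theorem theorem4p4:
  fixes A B Y B1 C1 :: "complex^'n^'n"
  assumes "positive_stable A" and "positive_stable B" and "positive_stable Y"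
    and "positive_stable B1" and "positive_stable C1" and "positive_stable (C1 - B1)"
    and "B1 ** C1 = C1 ** B1"
  shows "mat_holomorphic_on (ext_mhyp1F1 A B Y B1 C1) UNIV \<and>
    (\<forall>(n::nat) (z::complex).
       mat_nth_deriv n (ext_mhyp1F1 A B Y B1 C1) z =
         ext_mhyp1F1 A B Y (B1 + mat (of_nat n)) (C1 + mat (of_nat n)) z
           ** mpoch B1 n ** matrix_inv (mpoch C1 n))"
proof -
  define a where "a k = ext_mBeta A B Y (B1 + mat (of_nat k)) (C1 - B1) ** matrix_inv (mBeta B1 (C1 - B1))" for k
  obtain C where C: "\<And>k i j. norm (a k $ i $ j) \<le> C"
    using ext_mhyp1F1_sums(1)[of A B Y B1 C1] by (auto simp: a_def)
  have F: "(\<lambda>w. ext_mhyp1F1 A B Y B1 C1 w $ i $ j) = expo_series (\<lambda>k. a k $ i $ j)" for i j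
    by (simp add: ext_mhyp1F1_sums(3) a_def)
  have "expo_series (\<lambda>k. a k $ i $ j) field_differentiable at z" for i j z
    using expo_series_has_field_derivative[of "\<lambda>k. a k $ i $ j" C 1 z] C
    by (auto simp: field_differentiable_def)
  then have "mat_holomorphic_on (ext_mhyp1F1 A B Y B1 C1) UNIV"
    by (simp add: mat_holomorphic_on_def F holomorphic_on_def field_differentiable_at_within)
  moreover have "mat_nth_deriv n (ext_mhyp1F1 A B Y B1 C1) z =
         ext_mhyp1F1 A B Y (B1 + mat (of_nat n)) (C1 + mat (of_nat n)) z
           ** mpoch B1 n ** matrix_inv (mpoch C1 n)" (is "_ = ?R") for n z
  proof -
    have "mat_nth_deriv n (ext_mhyp1F1 A B Y B1 C1) z $ i $ j = ?R $ i $ j" for i j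
    proof -
      \<comment> \<open>The right-hand side has the coefficients of the original series shifted by
        \<open>n\<close>, which is what \<open>n\<close> differentiations produce.\<close>
      have "(\<lambda>m. a (m + n) ** mat (z ^ m / fact m)) sums ?R"
        unfolding a_def by (rule ext_mhyp1F1_shift) (use assms in auto)
      from sums_unique[OF bounded_linear.sums[OF bounded_linear_entry this]]
      have "?R $ i $ j = expo_series (\<lambda>m. a (m + n) $ i $ j) z"
        by (simp add: expo_series_def mult_ac)
      then show ?thesis
        using expo_series_nth_deriv[of "\<lambda>k. a k $ i $ j" C n] C by (simp add: mat_nth_deriv_def F)
    qed
    then show ?thesis by (simp add: vec_eq_iff)
  qed
  ultimately show ?thesis by blast
qed

end
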